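(* Let $\Gamma$ be a finite abelian group of order $n=\prod_p p^{v_p}$, and suppose that for each prime $p\mid n$, either $v_p<p-1$, or $p\le 3$ and $v_p<p$. Then every abelian Hopf-Galois structure on a Galois field extension $L/K$ with $\mathrm{Gal}(L/K)\cong\Gamma$ has type $\Gamma$; equivalently, $e_{\mathrm{ab}}(\Gamma)=e(\Gamma,\Gamma)$.
   Context: For finite groups $\Gamma,G$ of the same order, $e(\Gamma,G)$ is the number of Hopf-Galois structures of type $G$ on a Galois field extension with Galois group $\Gamma$; equivalently, the number of $\mathrm{Aut}(G)$-conjugacy classes of injective homomorphisms $\beta:\Gamma\to\mathrm{Hol}(G)$ whose image acts regularly on $G$, where $\mathrm{Hol}(G)=\rho(G)\cdot\mathrm{Aut}(G)\subseteq\mathrm{Perm}(G)$ and $\rho(g)(x)=xg^{-1}$. A Hopf-Galois structure is abelian if its type $G$ is abelian, and $e_{\mathrm{ab}}(\Gamma)=\sum_{G\text{ abelian}} e(\Gamma,G)$ over isomorphism classes of abelian groups $G$ of order $|\Gamma|$. *)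

theory Defs
  imports "HOL-Algebra.Algebra" "HOL-Computational_Algebra.Primes"
begin

text \<open>Permutations of carrier G are represented as functions restricted
(extensional) to carrier G; composition is \<open>compose (carrier G)\<close>.\<close>

definition rho_perm :: "('b, 'd) monoid_scheme \<Rightarrow> 'b \<Rightarrow> ('b \<Rightarrow> 'b)" where
  "rho_perm G g = (\<lambda>x\<in>carrier G. x \<otimes>\<^bsub>G\<^esub> inv\<^bsub>G\<^esub> g)"

definition Aut :: "('b, 'd) monoid_scheme \<Rightarrow> ('b \<Rightarrow> 'b) set" where
  "Aut G = {\<alpha>. \<alpha> \<in> iso G G \<and> \<alpha> \<in> extensional (carrier G)}"

definition Hol :: "('b, 'd) monoid_scheme \<Rightarrow> ('b \<Rightarrow> 'b) set" where
  "Hol G = {compose (carrier G) (rho_perm G g) \<alpha> | g \<alpha>. g \<in> carrier G \<and> \<alpha> \<in> Aut G}"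

definition regular_embeddings ::
  "('a, 'c) monoid_scheme \<Rightarrow> ('b, 'd) monoid_scheme \<Rightarrow> ('a \<Rightarrow> ('b \<Rightarrow> 'b)) set" where
  "regular_embeddings \<Gamma> G = {\<beta>. \<beta> \<in> extensional (carrier \<Gamma>)
      \<and> \<beta> \<in> carrier \<Gamma> \<rightarrow> Hol G
      \<and> (\<forall>x\<in>carrier \<Gamma>. \<forall>y\<in>carrier \<Gamma>.
            \<beta> (x \<otimes>\<^bsub>\<Gamma>\<^esub> y) = compose (carrier G) (\<beta> x) (\<beta> y))
      \<and> inj_on \<beta> (carrier \<Gamma>)
      \<and> (\<forall>u\<in>carrier G. \<forall>v\<in>carrier G. \<exists>!\<gamma>. \<gamma> \<in> carrier \<Gamma> \<and> \<beta> \<gamma> u = v)}"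

definition aut_conj ::
  "('a, 'c) monoid_scheme \<Rightarrow> ('b, 'd) monoid_scheme \<Rightarrow> ('a \<Rightarrow> ('b \<Rightarrow> 'b)) rel" where
  "aut_conj \<Gamma> G = {(\<beta>, \<beta>'). \<beta> \<in> regular_embeddings \<Gamma> G \<and> \<beta>' \<in> regular_embeddings \<Gamma> G
      \<and> (\<exists>\<alpha>\<in>Aut G. \<forall>\<gamma>\<in>carrier \<Gamma>.
            \<beta>' \<gamma> = compose (carrier G) \<alpha>
                     (compose (carrier G) (\<beta> \<gamma>) (restrict (inv_into (carrier G) \<alpha>) (carrier G))))}"

text \<open>e(Gamma, G): number of Hopf-Galois structures of type G on a Galois
extension with group Gamma (number of Aut(G)-conjugacy classes).\<close>
definition e_HGS :: "('a, 'c) monoid_scheme \<Rightarrow> ('b, 'd) monoid_scheme \<Rightarrow> nat" where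
  "e_HGS \<Gamma> G = card (regular_embeddings \<Gamma> G // aut_conj \<Gamma> G)"

end

theory Submission
  imports Defs "HOL-Number_Theory.Residues"
begin

text \<open>
  A regular abelian subgroup of Hol(G), with G abelian and written additively, turns G into a
  commutative nilpotent ring N such that the subgroup is isomorphic to N under the circle
  operation u + v + uv. The p-part of N has order p^v with v < p, so it
  is killed by every product of more than v factors, in particular by every product of p factors.
  Hence the additive order of a product of i elements of N is coprime to i!, the terms x^i / i!
  make sense, and the truncated exponential series is an injective homomorphism from (N, +) to
  the circle group; by cardinality it is an isomorphism.
\<close>

text \<open>The obstacle is division by i! on I, whose additive group is finite. A prime p blocks it
  only when p \<le> i, and then v < p gives i > v, so the p-part of every product of i factors has
  already vanished. Since i! is invertible only on such products, division is written as an integer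
  multiple: with n the order of the ring, i!^(phi(n) - 1) inverts i! there, and this integer is the
  same for all elements and all primes. Hence the ring is never split into primary components;
  multiplication by n / p^v isolates the p-part whenever one prime has to be looked at. The ring is
  placed as an ideal I in a ring with unit, because the series starts with 1 and because 1 + a turns
  the circle operation into multiplication: (1 + a)(1 + b) = 1 + (a + b + ab). Injectivity needs no
  logarithm: the series has the form 1 + x * unit, so its kernel is trivial.\<close>

no_notation ideal_prod (infixl \<open>\<cdot>\<index>\<close> 80)

section \<open>Products of elements of a finite radical ideal\<close>

text \<open>An ideal with this unit property lies in the Jacobson radical. Nilpotency is not
  assumed; it comes out of finiteness.\<close>

locale radical_ideal = cring R + ideal I R for R (structure) and I +
  assumes finite_ideal: "finite I"
    and one_plus_unit: "x \<in> I \<Longrightarrow> \<one> \<oplus> x \<in> Units R"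
begin

text \<open>Bare products, not the ideal power spanned by them: all later uses concern a single
  product such as x^i y^j. At 0 the value is the unit, which need not lie in I.\<close>

fun prods :: "nat \<Rightarrow> 'a set" where
  "prods 0 = {\<one>}"
| "prods (Suc k) = {x \<otimes> z | x z. x \<in> I \<and> z \<in> prods k}"

lemma prods_closed: "z \<in> prods k \<Longrightarrow> z \<in> carrier R"
  by (induction k arbitrary: z) (auto intro: Icarr)

lemma prods_Suc_subset: "prods (Suc k) \<subseteq> I"
  by (auto intro: I_r_closed prods_closed)

lemma pow_in_prods: "x \<in> I \<Longrightarrow> x [^] k \<in> prods k"
proof (induction k)
  case (Suc k)
  then have "x [^] Suc k = x \<otimes> x [^] k"
    by (simp add: Icarr m_comm)
  with Suc show ?case
    by auto
qed simp

lemma prods_mult: "y \<in> prods i \<Longrightarrow> z \<in> prods j \<Longrightarrow> y \<otimes> z \<in> prods (i + j)"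
proof (induction i arbitrary: y)
  case 0
  then show ?case by (auto simp: prods_closed)
next
  case (Suc i)
  then obtain x w where "y = x \<otimes> w" "x \<in> I" "w \<in> prods i" by auto
  moreover from this Suc have "w \<otimes> z \<in> prods (i + j)" by auto
  moreover have "y \<otimes> z = x \<otimes> (w \<otimes> z)"
    using calculation Suc.prems by (simp add: m_assoc Icarr prods_closed)
  ultimately show ?case by auto
qed

lemma prods_split:
  "z \<in> prods (i + j) \<Longrightarrow> \<exists>y\<in>prods i. \<exists>w\<in>prods j. z = y \<otimes> w"
proof (induction i arbitrary: z)
  case 0
  then show ?case by (auto simp: prods_closed)
next
  case (Suc i)
  then obtain x u where xu: "z = x \<otimes> u" "x \<in> I" "u \<in> prods (i + j)" by auto
  then obtain y w where yw: "y \<in> prods i" "w \<in> prods j" "u = y \<otimes> w"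
    using Suc.IH by blast
  have "z = (x \<otimes> y) \<otimes> w" "x \<otimes> y \<in> prods (Suc i)"
    using xu yw by (auto simp: m_assoc Icarr prods_closed)
  with yw show ?case by blast
qed

text \<open>Nakayama's argument for a principal module: (1 - x) w = 0 and 1 - x is a unit.\<close>

lemma mult_fixed_imp_zero:
  assumes "w \<in> carrier R" "x \<in> I" "w = w \<otimes> x"
  shows "w = \<zero>"
proof -
  have xc: "x \<in> carrier R" using assms Icarr by blast
  have u: "\<one> \<oplus> (\<ominus> x) \<in> Units R"
    using assms by (simp add: one_plus_unit)
  have "(\<one> \<oplus> (\<ominus> x)) \<otimes> w = w \<oplus> (\<ominus> (w \<otimes> x))"
    using assms(1) xc by (simp add: l_distr l_minus m_comm[of x w])
  also have "\<dots> = \<zero>"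
    using assms(1) by (simp add: r_neg flip: assms(3))
  finally have "(\<one> \<oplus> (\<ominus> x)) \<otimes> w = (\<one> \<oplus> (\<ominus> x)) \<otimes> \<zero>"
    using xc by simp
  then show ?thesis
    using u assms(1) Units_l_cancel by blast
qed

text \<open>An element z with the smallest set \<open>z \<otimes> I\<close> works, since \<open>x \<otimes> z \<notin> A\<close> would force
  \<open>x \<otimes> z\<close> to be a multiple of itself by an element of I.\<close>
lemma exists_minimal_outside:
  assumes "A \<subset> J" "J \<subseteq> I" "\<zero> \<in> A"
    and J: "\<And>x w. x \<in> I \<Longrightarrow> w \<in> J \<Longrightarrow> x \<otimes> w \<in> J"
  shows "\<exists>z\<in>J - A. \<forall>x\<in>I. x \<otimes> z \<in> A"
proof -
  have "\<exists>z. z \<in> J - A" using assms by blast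
  then obtain z where z: "z \<in> J - A"
    and min: "\<And>w. w \<in> J - A \<Longrightarrow> card ((\<lambda>y. w \<otimes> y) ` I) \<ge> card ((\<lambda>y. z \<otimes> y) ` I)"
    using ex_has_least_nat[of "\<lambda>z. z \<in> J - A" _ "\<lambda>z. card ((\<lambda>y. z \<otimes> y) ` I)"] by blast
  have zc: "z \<in> carrier R" using z assms Icarr by blast
  have "x \<otimes> z \<in> A" if x: "x \<in> I" for x
  proof (rule ccontr)
    assume "x \<otimes> z \<notin> A"
    then have w: "x \<otimes> z \<in> J - A" using J x z by blast
    have xc: "x \<in> carrier R" using x Icarr by blast
    have sub: "(\<lambda>y. x \<otimes> z \<otimes> y) ` I \<subseteq> (\<lambda>y. z \<otimes> y) ` I"
    proof
      fix u assume "u \<in> (\<lambda>y. x \<otimes> z \<otimes> y) ` I"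
      then obtain y where y: "y \<in> I" "u = x \<otimes> z \<otimes> y" by blast
      then have "u = z \<otimes> (x \<otimes> y)" using xc zc Icarr[OF y(1)] by (simp add: m_ac)
      then show "u \<in> (\<lambda>y. z \<otimes> y) ` I" using I_l_closed[OF y(1) xc] by blast
    qed
    have "(\<lambda>y. x \<otimes> z \<otimes> y) ` I = (\<lambda>y. z \<otimes> y) ` I"
      using card_seteq[OF _ sub min[OF w]] finite_ideal by blast
    moreover have "x \<otimes> z \<in> (\<lambda>y. z \<otimes> y) ` I"
      using x zc xc m_comm by blast
    ultimately obtain y where "y \<in> I" "x \<otimes> z = x \<otimes> z \<otimes> y" by blast
    then have "x \<otimes> z = \<zero>"
      using mult_fixed_imp_zero xc zc by blast
    with w assms show False by simp
  qed
  with z show ?thesis by blast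
qed

end

text \<open>Any other prime divisor q of the order would give, by Sylow, a subgroup of order q whose
  elements have order dividing both q and p^v. Subgroups in the annihilator chain below can thus
  only grow by factors of at least p.\<close>

lemma (in group) card_prime_power_if_killed:
  assumes "finite (carrier G)" "Factorial_Ring.prime (p::nat)"
    and kill: "\<And>x. x \<in> carrier G \<Longrightarrow> x [^] (p ^ v) = \<one>"
  shows "\<exists>k. order G = p ^ k"
proof -
  have "q = p" if q: "Factorial_Ring.prime q" "q dvd order G" for q :: nat
  proof (rule ccontr)
    assume "q \<noteq> p"
    then have cop: "coprime q (p ^ v)"
      using q assms primes_coprime by auto
    obtain m where "order G = q ^ 1 * m" using q by auto
    then obtain H where H: "subgroup H G" "card H = q"
      using sylow_thm[OF q(1) group_axioms _ assms(1)] by (metis power_one_right)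
    have HG: "group (G\<lparr>carrier := H\<rparr>)" using H subgroup_imp_group by blast
    have "h = \<one>" if h: "h \<in> H" for h
    proof -
      have hc: "h \<in> carrier G" by (rule subgroup.mem_carrier[OF H(1) h])
      have "h [^]\<^bsub>G\<lparr>carrier := H\<rparr>\<^esub> order (G\<lparr>carrier := H\<rparr>) = \<one>\<^bsub>G\<lparr>carrier := H\<rparr>\<^esub>"
        using group.pow_order_eq_1[OF HG] h by simp
      then have "h [^] q = \<one>"
        using H nat_pow_consistent[of h q H] by (simp add: order_def)
      then have "ord h dvd q" "ord h dvd p ^ v"
        using kill[OF hc] pow_eq_id[OF hc] by blast+
      then have "ord h = 1" using coprime_common_divisor[OF cop] by simp
      then show ?thesis using hc ord_eq_1 by blast
    qed
    then have "H \<subseteq> {\<one>}" by blast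
    then have "card H \<le> 1"
      using card_mono[of "{\<one>}" H] by simp
    then show False using prime_gt_1_nat[OF q(1)] H(2) by simp
  qed
  note only_p = this
  have "order G \<noteq> 0" using assms(1) order_gt_0_iff_finite by simp
  then obtain m where m: "order G = p ^ multiplicity p (order G) * m" "\<not> p dvd m"
    using multiplicity_decompose'[of "order G" p] prime_gt_1_nat[OF assms(2)] by auto
  have "m = 1"
  proof (rule ccontr)
    assume "m \<noteq> 1"
    then obtain q where "Factorial_Ring.prime q" "q dvd m" using prime_factor_nat by blast
    then show False using only_p[of q] m dvd_mult by metis
  qed
  with m(1) show ?thesis by (metis mult.right_neutral)
qed

section \<open>Nilpotency bounds for the p-part of the ideal\<close>

context radical_ideal
begin

lemma additive_subgroup_card_prime_power:
  assumes A: "subgroup A (add_monoid R)" "A \<subseteq> I" and p: "Factorial_Ring.prime (p::nat)"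
    and kill: "\<And>x. x \<in> A \<Longrightarrow> [(p ^ v)] \<cdot> x = \<zero>"
  shows "\<exists>k. card A = p ^ k"
proof -
  interpret A: group "(add_monoid R)\<lparr>carrier := A\<rparr>"
    by (rule group.subgroup_imp_group[OF a_group A(1)])
  have "x [^]\<^bsub>(add_monoid R)\<lparr>carrier := A\<rparr>\<^esub> (p ^ v) = \<zero>" if "x \<in> A" for x
    using kill[OF that] monoid.nat_pow_consistent[OF a_monoid, of x "p ^ v" A]
    by (simp add: add_pow_def)
  then show ?thesis
    using A.card_prime_power_if_killed[OF _ p, of v] finite_subset[OF A(2) finite_ideal]
    by (simp add: order_def)
qed

lemma card_ideal_pos: "card I > 0"
proof -
  have "\<zero> \<in> I" by simp
  then have "I \<noteq> {}" by blast
  with finite_ideal show ?thesis by (simp add: card_gt_0_iff)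
qed

lemma card_scalar_zero: "x \<in> I \<Longrightarrow> [card I] \<cdot> x = \<zero>"
proof -
  assume x: "x \<in> I"
  interpret I: group "(add_monoid R)\<lparr>carrier := I\<rparr>"
    by (rule group.subgroup_imp_group[OF a_group a_subgroup])
  show ?thesis
    using I.pow_order_eq_1 x monoid.nat_pow_consistent[OF a_monoid, of x "card I" I]
    by (simp add: add_pow_def order_def)
qed

lemma scalar_in_ideal: "x \<in> I \<Longrightarrow> [(k::nat)] \<cdot> x \<in> I"
  by (induction k) (auto simp: Icarr)

text \<open>\<open>J\<close> is the p-part of I. Inside it, the annihilators \<open>A j\<close> of
  all products of j factors form a chain of p-groups starting at the zero subgroup. As
  \<open>J\<close> has at most p^v elements, v strict steps exhaust it. Counting annihilators from
  below avoids any need for additive spans of products.\<close>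

lemma torsion_annihilated:
  fixes p :: nat
  defines "v \<equiv> multiplicity p (card I)"
  assumes p: "Factorial_Ring.prime p"
    and w: "w \<in> I" "[(p ^ v)] \<cdot> w = \<zero>" and z: "z \<in> prods v"
  shows "z \<otimes> w = \<zero>"
proof -
  define J where "J = {x \<in> I. [(p ^ v)] \<cdot> x = \<zero>}"
  define A where "A j = {w \<in> J. \<forall>z\<in>prods j. z \<otimes> w = \<zero>}" for j
  have JI: "J \<subseteq> I" by (auto simp: J_def)
  have J_mult: "x \<otimes> w \<in> J" if "x \<in> I" "w \<in> J" for x w
  proof -
    have c: "x \<in> carrier R" "w \<in> carrier R" "w \<in> I" "[(p ^ v)] \<cdot> w = \<zero>"
      using that Icarr by (auto simp: J_def)
    then have "[(p ^ v)] \<cdot> (x \<otimes> w) = \<zero>"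
      using add_pow_rdistr[of x w "p ^ v"] by simp
    with c show ?thesis by (simp add: J_def I_l_closed)
  qed
  have J_sub: "subgroup J (add_monoid R)"
  proof (rule add.subgroupI)
    show "J \<subseteq> carrier R" using JI Icarr by blast
    have "\<zero> \<in> J" by (simp add: J_def)
    then show "J \<noteq> {}" by blast
    show "\<ominus> a \<in> J" if "a \<in> J" for a
      using that Icarr add.nat_pow_inv[of a "p ^ v"] by (auto simp: J_def)
    show "a \<oplus> b \<in> J" if "a \<in> J" "b \<in> J" for a b
      using that Icarr add.nat_pow_distrib[of a b "p ^ v"] by (auto simp: J_def)
  qed
  have A_sub: "subgroup (A j) (add_monoid R)" for j
  proof (rule add.subgroupI)
    show "A j \<subseteq> carrier R" using JI Icarr by (auto simp: A_def)
    have "\<zero> \<in> A j" by (simp add: A_def J_def prods_closed)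
    then show "A j \<noteq> {}" by blast
    show "\<ominus> a \<in> A j" if "a \<in> A j" for a
      using that Icarr JI subgroup.m_inv_closed[OF J_sub, of a]
      by (auto simp: A_def r_minus prods_closed subset_iff a_inv_def[symmetric])
    show "a \<oplus> b \<in> A j" if "a \<in> A j" "b \<in> A j" for a b
      using that Icarr JI subgroup.m_closed[OF J_sub, of a b]
      by (auto simp: A_def r_distr prods_closed subset_iff)
  qed
  have finJ: "finite J" using JI finite_ideal finite_subset by blast
  have A_power: "\<exists>k. card (A j) = p ^ k" for j
  proof (rule additive_subgroup_card_prime_power[OF A_sub _ p])
    show "A j \<subseteq> I" using JI by (auto simp: A_def)
    show "[(p ^ v)] \<cdot> x = \<zero>" if "x \<in> A j" for x
      using that by (simp add: A_def J_def)
  qed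
  obtain k where k: "card J = p ^ k"
    using additive_subgroup_card_prime_power[OF J_sub JI p, of v] by (auto simp: J_def)
  have "card J dvd card I"
  proof -
    interpret I: group "(add_monoid R)\<lparr>carrier := I\<rparr>"
      by (rule group.subgroup_imp_group[OF a_group a_subgroup])
    have "subgroup J ((add_monoid R)\<lparr>carrier := I\<rparr>)"
      using group.subgroup_incl[OF a_group J_sub a_subgroup JI] .
    then have "card (rcosets\<^bsub>(add_monoid R)\<lparr>carrier := I\<rparr>\<^esub> J) * card J = card I"
      using I.lagrange by (simp add: order_def)
    then show ?thesis by (metis dvd_triv_right)
  qed
  \<comment> \<open>By Lagrange p^k divides \<open>card I\<close>, in which p occurs exactly v
    times.\<close>
  then have "k \<le> v"
    unfolding v_def k using card_ideal_pos p
    by (intro multiplicity_geI) (auto simp: prime_gt_0_nat)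
  have A_mono: "A j \<subseteq> A (Suc j)" for j
  proof
    fix w assume w: "w \<in> A j"
    then have wc: "w \<in> carrier R" using JI Icarr by (auto simp: A_def)
    have "x \<otimes> z \<otimes> w = \<zero>" if "x \<in> I" "z \<in> prods j" for x z
      using that w wc Icarr by (simp add: A_def m_assoc prods_closed)
    with w show "w \<in> A (Suc j)" by (auto simp: A_def)
  qed
  \<comment> \<open>The annihilators grow strictly until they exhaust J, each step by a factor at least p.\<close>
  have grow: "A j = J \<or> p ^ j \<le> card (A j)" for j
  proof (induction j)
    case 0
    have "A 0 \<noteq> {}" using subgroup.one_closed[OF A_sub[of 0]] by auto
    moreover have "finite (A 0)" using finJ by (simp add: A_def)
    ultimately show ?case by (simp add: Suc_le_eq card_gt_0_iff)
  next
    case (Suc j)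
    show ?case
    proof (cases "A j = J")
      case True
      then show ?thesis using A_mono[of j] by (auto simp: A_def)
    next
      case False
      then have "A j \<subset> J" by (auto simp: A_def)
      moreover have "\<zero> \<in> A j" using subgroup.one_closed[OF A_sub[of j]] by simp
      \<comment> \<open>Such a u is new in \<open>A (Suc j)\<close>: one factor from I moves it into
        \<open>A j\<close>, and the other j factors then kill it.\<close>
      ultimately obtain u where u: "u \<in> J - A j" "\<forall>x\<in>I. x \<otimes> u \<in> A j"
        using exists_minimal_outside[of "A j" J] JI J_mult by blast
      have uc: "u \<in> carrier R" using u JI Icarr by blast
      have "x \<otimes> z \<otimes> u = \<zero>" if "x \<in> I" "z \<in> prods j" for x z
      proof -
        have "x \<otimes> z \<otimes> u = z \<otimes> (x \<otimes> u)"
          using that uc Icarr[of x] prods_closed[of z] by (simp add: m_ac)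
        then show ?thesis using u that by (simp add: A_def)
      qed
      then have "u \<in> A (Suc j)" using u by (auto simp: A_def)
      then have "A j \<subset> A (Suc j)" using u A_mono by blast
      moreover have "finite (A (Suc j))" using finJ by (simp add: A_def)
      ultimately have less: "card (A j) < card (A (Suc j))" by (rule psubset_card_mono[rotated])
      obtain a b where ab: "card (A j) = p ^ a" "card (A (Suc j)) = p ^ b"
        using A_power by blast
      have "1 < p" using p prime_gt_1_nat by blast
      then have "a < b" "j \<le> a"
        using less ab False Suc.IH by (auto simp: power_less_imp_less_exp)
      then have "p ^ Suc j \<le> p ^ b"
        using \<open>1 < p\<close> by (intro power_increasing) auto
      then show ?thesis using ab by simp
    qed
  qed
  have "A v = J"
  proof (rule ccontr)
    assume ne: "A v \<noteq> J"
    then have "p ^ k \<le> card (A v)"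
      using grow[of v] \<open>k \<le> v\<close> power_increasing[of k v p] prime_gt_0_nat[OF p] by simp
    then have "A v = J"
      using k finJ by (intro card_seteq) (auto simp: A_def)
    with ne show False ..
  qed
  moreover have "w \<in> J" using w by (simp add: J_def)
  ultimately show ?thesis using z by (auto simp: A_def)
qed

text \<open>Multiplying by the cofactor n / p^v moves an element of I into the p-torsion, where v
  further factors annihilate it. This says that z has trivial p-part.\<close>

lemma prods_killed:
  fixes p :: nat
  assumes p: "Factorial_Ring.prime p" and small: "multiplicity p (card I) < i"
    and z: "z \<in> prods i"
  shows "[(card I div p ^ multiplicity p (card I))] \<cdot> z = \<zero>"
proof -
  define v where "v = multiplicity p (card I)"
  define r where "r = card I div p ^ v"
  have r: "p ^ v * r = card I" by (simp add: r_def v_def multiplicity_dvd)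
  \<comment> \<open>The strict inequality matters: v factors go into y, and at least one remains, so
    that w lies in I.\<close>
  obtain k where "i = v + Suc k" using small less_imp_Suc_add v_def by auto
  then obtain y w where yw: "y \<in> prods v" "w \<in> prods (Suc k)" "z = y \<otimes> w"
    using prods_split z by blast
  then have w: "w \<in> I" using prods_Suc_subset by blast
  have c: "y \<in> carrier R" "w \<in> carrier R" using yw prods_closed by auto
  have "[(p ^ v)] \<cdot> ([r] \<cdot> w) = \<zero>"
    using card_scalar_zero[OF w] c r by (simp add: add.nat_pow_pow mult.commute)
  then have "y \<otimes> ([r] \<cdot> w) = \<zero>"
    using torsion_annihilated[OF p scalar_in_ideal[OF w]] yw v_def by blast
  then show ?thesis
    using c yw add_pow_rdistr[of y w r] by (simp add: r_def v_def)
qed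

end

section \<open>Inverting factorials on products of ring elements\<close>

locale small_radical_ideal = radical_ideal +
  assumes multiplicity_less:
    "\<lbrakk>Factorial_Ring.prime p; p dvd card I\<rbrakk> \<Longrightarrow> multiplicity p (card I) < p"
begin

text \<open>The bound v < p enters here. A prime p common to i! and the additive order d of z
  satisfies p \<le> i, hence v < i, so d divides n / p^v, which is prime to p. Thus i! is a unit
  modulo d and Euler's theorem applies.\<close>

lemma fact_power_fixes:
  assumes z: "z \<in> prods i"
  shows "[(fact i ^ totient (card I) :: nat)] \<cdot> z = z"
proof (cases i)
  \<comment> \<open>Here z is the unit of R, possibly of infinite additive order, but the
    coefficient is 1.\<close>
  case 0
  then show ?thesis using prods_closed[OF z] by simp
next
  case (Suc k)
  have zI: "z \<in> I" using z Suc prods_Suc_subset by blast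
  have zc: "z \<in> carrier R" using prods_closed[OF z] .
  define d where "d = group.ord (add_monoid R) z"
  have kill_iff: "[m] \<cdot> z = \<zero> \<longleftrightarrow> d dvd m" for m :: nat
    using group.pow_eq_id[OF a_group, of z m] zc by (simp add: add_pow_def d_def)
  have dn: "d dvd card I" using kill_iff card_scalar_zero[OF zI] by blast
  have "coprime (fact i) d"
  proof (rule ccontr)
    assume "\<not> coprime (fact i) d"
    then obtain p where p: "Factorial_Ring.prime p" "p dvd fact i" "p dvd d"
      using prime_factor_nat[of "gcd (fact i) d"] by (auto simp: coprime_iff_gcd_eq_1)
    then have "p \<le> i" using prime_dvd_fact_iff by blast
    then have "multiplicity p (card I) < i"
      using multiplicity_less[OF p(1)] p(3) dn dvd_trans by fastforce
    then have "d dvd card I div p ^ multiplicity p (card I)"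
      using prods_killed[OF p(1) _ z] kill_iff by blast
    then have "p dvd card I div p ^ multiplicity p (card I)" using p(3) dvd_trans by blast
    then show False
      using multiplicity_decompose[of "card I" p] card_ideal_pos prime_gt_1_nat[OF p(1)] by simp
  qed
  then have "[fact i ^ totient d = 1] (mod d)" by (rule euler_theorem)
  \<comment> \<open>\<open>totient d\<close> divides \<open>totient (card I)\<close>, so one
    exponent serves every z whatever its order.\<close>
  moreover obtain m where "totient (card I) = totient d * m"
    using totient_dvd[OF dn] by blast
  ultimately have "[fact i ^ totient (card I) = 1] (mod d)"
    using cong_pow[of "fact i ^ totient d" 1 d m] by (simp add: power_mult)
  moreover have "(fact i ^ totient (card I) :: nat) \<ge> 1" by simp
  ultimately have "d dvd fact i ^ totient (card I) - 1"
    using cong_altdef_nat by (metis cong_sym cong_diff_iff_cong_0_nat cong_0_iff)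
  then have "[(fact i ^ totient (card I) - 1 :: nat)] \<cdot> z = \<zero>"
    using kill_iff by blast
  moreover have "[(fact i ^ totient (card I) - 1 + 1 :: nat)] \<cdot> z
      = [(fact i ^ totient (card I) - 1 :: nat)] \<cdot> z \<oplus> [(1::nat)] \<cdot> z"
    using add.nat_pow_mult[OF zc] by metis
  ultimately show ?thesis
    using zc by simp
qed

end

section \<open>The truncated exponential\<close>

context cring
begin

lemma add_pow_finsum:
  assumes "finite A" "f \<in> A \<rightarrow> carrier R"
  shows "[(c::nat)] \<cdot> finsum R f A = (\<Oplus>i\<in>A. [c] \<cdot> f i)"
  using assms
proof (induction A rule: finite_induct)
  case empty
  then show ?case by simp
next
  case (insert a A)
  then have "f \<in> A \<rightarrow> carrier R" "f a \<in> carrier R" by auto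
  with insert show ?case
    by (simp add: add.nat_pow_distrib finsum_insert Pi_iff)
qed

lemma binomial_expansion:
  assumes x: "x \<in> carrier R" and y: "y \<in> carrier R"
  shows "(x \<oplus> y) [^] (n::nat) = (\<Oplus>i\<in>{..n}. [(n choose i)] \<cdot> (x [^] i \<otimes> y [^] (n - i)))"
proof (induction n)
  case 0
  then show ?case by simp
next
  case (Suc n)
  define t where "t i = x [^] i \<otimes> y [^] (Suc n - i)" for i
  have t: "t i \<in> carrier R" for i using x y by (simp add: t_def)
  define S where "S = (\<Oplus>i\<in>{..n}. [(n choose i)] \<cdot> (x [^] i \<otimes> y [^] (n - i)))"
  have S: "S \<in> carrier R" using x y by (auto simp: S_def intro!: finsum_closed)
  have Sx: "x \<otimes> S = (\<Oplus>i\<in>{..n}. [(n choose i)] \<cdot> t (Suc i))"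
    unfolding S_def
  proof (subst finsum_rdistr; (use x y in \<open>simp; fail\<close>)?)
    show "(\<Oplus>i\<in>{..n}. x \<otimes> [(n choose i)] \<cdot> (x [^] i \<otimes> y [^] (n - i)))
        = (\<Oplus>i\<in>{..n}. [(n choose i)] \<cdot> t (Suc i))"
    proof (rule finsum_cong')
      fix i
      have "x \<otimes> (x [^] i \<otimes> y [^] (n - i)) = t (Suc i)"
        using x y by (simp add: t_def m_ac)
      then show "x \<otimes> [(n choose i)] \<cdot> (x [^] i \<otimes> y [^] (n - i)) = [(n choose i)] \<cdot> t (Suc i)"
        using x y by (simp add: add_pow_rdistr)
    qed (use t in auto)
  qed
  have Sy: "y \<otimes> S = (\<Oplus>i\<in>{..n}. [(n choose i)] \<cdot> t i)"
    unfolding S_def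
  proof (subst finsum_rdistr; (use x y in \<open>simp; fail\<close>)?)
    show "(\<Oplus>i\<in>{..n}. y \<otimes> [(n choose i)] \<cdot> (x [^] i \<otimes> y [^] (n - i)))
        = (\<Oplus>i\<in>{..n}. [(n choose i)] \<cdot> t i)"
    proof (rule finsum_cong')
      fix i assume "i \<in> {..n}"
      then have "y \<otimes> (x [^] i \<otimes> y [^] (n - i)) = t i"
        using x y by (simp add: t_def Suc_diff_le m_ac)
      then show "y \<otimes> [(n choose i)] \<cdot> (x [^] i \<otimes> y [^] (n - i)) = [(n choose i)] \<cdot> t i"
        using x y by (simp add: add_pow_rdistr)
    qed (use t in auto)
  qed
  define U where "U = (\<Oplus>i\<in>{..n}. [(n choose Suc i)] \<cdot> t (Suc i))"
  have U: "U \<in> carrier R" using t by (auto simp: U_def intro!: finsum_closed)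
  have "(\<Oplus>i\<in>{..Suc n}. [(n choose i)] \<cdot> t i) = U \<oplus> t 0"
    unfolding U_def by (subst finsum_Suc2) (use t in auto)
  \<comment> \<open>The added top term has coefficient \<open>n choose Suc n = 0\<close>. Splitting
    the same sum at its bottom and at its top yields the index shift needed for Pascal's
    rule.\<close>
  moreover have "(\<Oplus>i\<in>{..Suc n}. [(n choose i)] \<cdot> t i) = y \<otimes> S"
    unfolding Sy by (subst finsum_Suc) (use t in \<open>auto simp: binomial_eq_0 intro!: finsum_closed l_zero\<close>)
  ultimately have yS: "y \<otimes> S = U \<oplus> t 0" by simp
  have "(\<Oplus>i\<in>{..Suc n}. [(Suc n choose i)] \<cdot> t i)
      = (\<Oplus>i\<in>{..n}. [(Suc n choose Suc i)] \<cdot> t (Suc i)) \<oplus> t 0"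
    by (subst finsum_Suc2) (use t in auto)
  also have "(\<Oplus>i\<in>{..n}. [(Suc n choose Suc i)] \<cdot> t (Suc i))
      = (\<Oplus>i\<in>{..n}. [(n choose i)] \<cdot> t (Suc i) \<oplus> [(n choose Suc i)] \<cdot> t (Suc i))"
    by (rule finsum_cong') (use t in \<open>auto simp: add.nat_pow_mult\<close>)
  also have "\<dots> = x \<otimes> S \<oplus> U"
    unfolding Sx U_def by (rule finsum_addf) (use t in auto)
  also have "x \<otimes> S \<oplus> U \<oplus> t 0 = x \<otimes> S \<oplus> y \<otimes> S"
    using x S U t by (simp add: yS a_assoc)
  also have "\<dots> = (x \<oplus> y) [^] Suc n"
    using x y S Suc.IH by (simp add: S_def[symmetric] l_distr m_comm[of S])
  finally show ?case by (simp add: t_def)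
qed

lemma finsum_atMost_extend:
  fixes n m :: nat
  assumes "\<And>i. f i \<in> carrier R" "\<And>i. n < i \<Longrightarrow> f i = \<zero>"
  shows "finsum R f {..n + m} = finsum R f {..n}"
proof (induct m)
  case (Suc m)
  then show ?case using assms by (simp add: Pi_iff)
qed simp

end

section \<open>Divided powers and the exponential series\<close>

context small_radical_ideal
begin

text \<open>By Euler's theorem the coefficient inverts \<open>i!\<close> modulo the additive order of \<open>x [^] i\<close>,
  so this is \<open>x^i / i!\<close>.\<close>
definition divpow :: "'a \<Rightarrow> nat \<Rightarrow> 'a" where
  "divpow x i = [(fact i ^ (totient (card I) - 1) :: nat)] \<cdot> (x [^] i)"

text \<open>The cut-off is crude but loses nothing: all terms of degree at least
  \<open>card I\<close> vanish by \<open>power_vanishes\<close>.\<close>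

definition expo :: "'a \<Rightarrow> 'a" where
  "expo x = (\<Oplus>i\<in>{..card I}. divpow x i)"

lemma divpow_closed: "x \<in> I \<Longrightarrow> divpow x i \<in> carrier R"
  by (simp add: divpow_def Icarr)

lemma divpow_0 [simp]: "divpow x 0 = \<one>"
  by (simp add: divpow_def)

lemma divpow_1: "x \<in> I \<Longrightarrow> divpow x (Suc 0) = x"
  by (simp add: divpow_def Icarr)

lemma fact_mult_coeff:
  "(fact i :: nat) * fact i ^ (totient (card I) - 1) = fact i ^ totient (card I)"
  using card_ideal_pos by (simp flip: power_Suc)

text \<open>For i \<ge> n the order n divides i!, so the multiplier that fixes x^i also kills
  it.\<close>

lemma power_vanishes:
  assumes x: "x \<in> I" and i: "card I \<le> i"
  shows "x [^] i = \<zero>"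
proof -
  have "i = Suc (i - 1)" using card_ideal_pos i by simp
  then have xI: "x [^] i \<in> I"
    using pow_in_prods[OF x, of i] prods_Suc_subset[of "i - 1"] by (metis subsetD)
  have "card I dvd fact i ^ totient (card I)"
    using card_ideal_pos i by (intro dvd_power_le[of _ _ 1, simplified]) (auto intro: dvd_fact simp: Suc_le_eq)
  then obtain m where "fact i ^ totient (card I) = card I * m" by blast
  then have "[(fact i ^ totient (card I) :: nat)] \<cdot> (x [^] i) = [m] \<cdot> ([card I] \<cdot> (x [^] i))"
    using x Icarr by (simp add: add.nat_pow_pow)
  then show ?thesis
    using fact_power_fixes[OF pow_in_prods[OF x]] card_scalar_zero[OF xI] by simp
qed

text \<open>In fractions, x^i/i! * y^j/j! = (k choose i)/k! * x^i y^j with k = i + j. The inverses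
  \<open>c\<close> work only on elements that the factorial multiples fix. So k! \<open>c k\<close>,
  which fixes z, is inserted, k! is rewritten as (k choose i) i! j!, and the factors i!
  \<open>c i\<close> and j! \<open>c j\<close>, which also fix z, are absorbed.\<close>

lemma divpow_mult:
  assumes x: "x \<in> I" and y: "y \<in> I" and "i \<le> k"
  shows "divpow x i \<otimes> divpow y (k - i)
    = [(fact k ^ (totient (card I) - 1) * (k choose i) :: nat)] \<cdot> (x [^] i \<otimes> y [^] (k - i))"
proof -
  define j where "j = k - i"
  have k: "k = i + j" using assms by (simp add: j_def)
  define c where "c i = (fact i :: nat) ^ (totient (card I) - 1)" for i
  have c: "(fact i :: nat) * c i = fact i ^ totient (card I)" for i
    using fact_mult_coeff by (simp add: c_def)
  define z where "z = x [^] i \<otimes> y [^] j"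
  have carr [simp]: "x \<in> carrier R" "y \<in> carrier R" using x y Icarr by auto
  have zc [simp]: "z \<in> carrier R" by (simp add: z_def)
  have zk: "[(fact k * c k)] \<cdot> z = z"
    unfolding c k z_def by (intro fact_power_fixes prods_mult pow_in_prods x y)
  have zi: "[(fact i * c i)] \<cdot> z = z"
    using fact_power_fixes[OF pow_in_prods[OF x], of i] add_pow_ldistr[of "x [^] i" "y [^] j"]
    unfolding c z_def by (metis carr nat_pow_closed)
  have zj: "[(fact j * c j)] \<cdot> z = z"
    using fact_power_fixes[OF pow_in_prods[OF y], of j] add_pow_rdistr[of "x [^] i" "y [^] j"]
    unfolding c z_def by (metis carr nat_pow_closed)
  have "(fact k :: nat) = (k choose i) * (fact i * fact j)"
    using binomial_fact_lemma[of i k] assms(3) by (simp add: j_def mult_ac)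
  then have eq: "c i * c j * (fact k * c k) = c k * (k choose i) * ((fact i * c i) * (fact j * c j))"
    by (simp add: mult_ac)
  have "divpow x i \<otimes> divpow y j = [(c i * c j)] \<cdot> z"
    by (simp add: divpow_def c_def z_def add_pow_ldistr add_pow_rdistr add.nat_pow_pow mult.commute)
  also have "\<dots> = [(c i * c j)] \<cdot> ([(fact k * c k)] \<cdot> z)" by (simp only: zk)
  also have "\<dots> = [(c k * (k choose i) * ((fact i * c i) * (fact j * c j)))] \<cdot> z"
    by (simp only: add.nat_pow_pow[OF zc] eq[symmetric] mult.commute)
  also have "\<dots> = [(c k * (k choose i))] \<cdot> ([(fact i * c i)] \<cdot> ([(fact j * c j)] \<cdot> z))"
    by (simp only: add.nat_pow_pow[OF zc] add.nat_pow_pow[OF add.nat_pow_closed[OF zc]] mult_ac)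
  also have "\<dots> = [(c k * (k choose i))] \<cdot> z" by (simp only: zi zj)
  finally show ?thesis by (simp add: j_def z_def c_def)
qed

lemma divpow_add:
  assumes x: "x \<in> I" and y: "y \<in> I"
  shows "divpow (x \<oplus> y) k = (\<Oplus>i\<in>{..k}. divpow x i \<otimes> divpow y (k - i))"
proof -
  have carr: "x \<in> carrier R" "y \<in> carrier R" using x y Icarr by auto
  let ?c = "fact k ^ (totient (card I) - 1) :: nat"
  have "divpow (x \<oplus> y) k
      = (\<Oplus>i\<in>{..k}. [?c] \<cdot> ([(k choose i)] \<cdot> (x [^] i \<otimes> y [^] (k - i))))"
    unfolding divpow_def binomial_expansion[OF carr] by (rule add_pow_finsum) (use carr in auto)
  also have "\<dots> = (\<Oplus>i\<in>{..k}. divpow x i \<otimes> divpow y (k - i))"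
    by (rule finsum_cong')
      (use carr x y in \<open>auto simp: divpow_mult add.nat_pow_pow mult.commute divpow_closed\<close>)
  finally show ?thesis .
qed

lemma divpow_vanishes: "x \<in> I \<Longrightarrow> card I \<le> i \<Longrightarrow> divpow x i = \<zero>"
  by (simp add: divpow_def power_vanishes)

lemma expo_closed: "x \<in> I \<Longrightarrow> expo x \<in> carrier R"
  unfolding expo_def by (intro finsum_closed) (auto simp: divpow_closed)

lemma expo_add:
  assumes x: "x \<in> I" and y: "y \<in> I"
  shows "expo (x \<oplus> y) = expo x \<otimes> expo y"
proof -
  \<comment> \<open>The Cauchy product runs up to the sum of the two degree bounds; the surplus
    terms vanish and are cut off afterwards.\<close>
  have "expo x \<otimes> expo y
      = (\<Oplus>k\<in>{..card I + card I}. \<Oplus>i\<in>{..k}. divpow x i \<otimes> divpow y (k - i))"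
    unfolding expo_def
    by (rule cauchy_product[symmetric])
      (use x y in \<open>auto simp: divpow_closed divpow_vanishes intro!: bound.intro\<close>)
  also have "\<dots> = (\<Oplus>k\<in>{..card I + card I}. divpow (x \<oplus> y) k)"
    using x y by (simp add: divpow_add)
  also have "\<dots> = expo (x \<oplus> y)"
    unfolding expo_def using x y
    by (intro finsum_atMost_extend) (auto simp: divpow_closed divpow_vanishes)
  finally show ?thesis by simp
qed

text \<open>Every term of positive degree contains a factor x, and from degree 2 on the cofactor is
  in I. The resulting 1 + w is a unit, which makes the kernel of \<open>expo\<close> trivial; the
  formula also places \<open>expo x\<close> in 1 + I.\<close>

lemma expo_leading_terms:
  assumes x: "x \<in> I"
  shows "\<exists>w\<in>I. expo x = \<one> \<oplus> x \<otimes> (\<one> \<oplus> w)"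
proof -
  have xc: "x \<in> carrier R" using x Icarr by blast
  have "\<exists>w\<in>I. (\<Oplus>i\<in>{..m}. divpow x (Suc i)) = x \<otimes> (\<one> \<oplus> w)" for m
  proof (induction m)
    case 0
    have "(\<Oplus>i\<in>{..0}. divpow x (Suc i)) = x \<otimes> (\<one> \<oplus> \<zero>)"
      using xc x by (simp add: divpow_1)
    then show ?case using zero_closed by blast
  next
    case (Suc m)
    then obtain w where w: "w \<in> I" "(\<Oplus>i\<in>{..m}. divpow x (Suc i)) = x \<otimes> (\<one> \<oplus> w)" by blast
    define u where "u = [(fact (Suc (Suc m)) ^ (totient (card I) - 1) :: nat)] \<cdot> (x [^] Suc m)"
    have u: "u \<in> I"
      unfolding u_def using pow_in_prods[OF x] prods_Suc_subset
      by (intro scalar_in_ideal) blast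
    have carr: "w \<in> carrier R" "u \<in> carrier R" using w u Icarr by auto
    have "divpow x (Suc (Suc m)) = x \<otimes> u"
      using xc by (simp add: divpow_def u_def add_pow_rdistr m_comm del: fact_Suc)
    then have "(\<Oplus>i\<in>{..Suc m}. divpow x (Suc i)) = x \<otimes> u \<oplus> x \<otimes> (\<one> \<oplus> w)"
      using x w by (simp add: divpow_closed Pi_iff)
    also have "\<dots> = x \<otimes> (\<one> \<oplus> (u \<oplus> w))"
      using xc carr by (simp add: r_distr a_ac)
    finally show ?case using u w a_closed by blast
  qed
  then obtain w where w: "w \<in> I"
    "(\<Oplus>i\<in>{..card I - 1}. divpow x (Suc i)) = x \<otimes> (\<one> \<oplus> w)" by blast
  have "expo x = (\<Oplus>i\<in>{..Suc (card I - 1)}. divpow x i)"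
    using card_ideal_pos by (simp add: expo_def)
  also have "\<dots> = (\<Oplus>i\<in>{..card I - 1}. divpow x (Suc i)) \<oplus> \<one>"
    by (subst finsum_Suc2) (use x in \<open>auto simp: divpow_closed\<close>)
  also have "\<dots> = \<one> \<oplus> x \<otimes> (\<one> \<oplus> w)"
    unfolding w(2) using xc w(1) Icarr by (intro a_comm) auto
  finally show ?thesis using w(1) by blast
qed

lemma expo_eq_one:
  assumes x: "x \<in> I" and "expo x = \<one>"
  shows "x = \<zero>"
proof -
  have xc: "x \<in> carrier R" using x Icarr by blast
  obtain w where w: "w \<in> I" "\<one> = \<one> \<oplus> x \<otimes> (\<one> \<oplus> w)"
    using expo_leading_terms[OF x] assms(2) by auto
  have wc: "w \<in> carrier R" using w Icarr by blast
  have "x \<otimes> (\<one> \<oplus> w) = \<zero>"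
    using w(2) xc wc add.r_cancel_one'[of "x \<otimes> (\<one> \<oplus> w)" \<one>] a_comm by auto
  then have "(\<one> \<oplus> w) \<otimes> x = (\<one> \<oplus> w) \<otimes> \<zero>"
    using xc wc by (simp add: m_comm)
  then show ?thesis
    using one_plus_unit[OF w(1)] Units_l_cancel xc by blast
qed

theorem truncated_exponential:
  "\<exists>e. e \<in> I \<rightarrow> I \<and> inj_on e I \<and>
    (\<forall>x\<in>I. \<forall>y\<in>I. \<one> \<oplus> e (x \<oplus> y) = (\<one> \<oplus> e x) \<otimes> (\<one> \<oplus> e y))"
proof -
  have "\<exists>u\<in>I. expo x = \<one> \<oplus> u" if x: "x \<in> I" for x
  proof -
    obtain w where w: "w \<in> I" "expo x = \<one> \<oplus> x \<otimes> (\<one> \<oplus> w)"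
      using expo_leading_terms[OF x] by blast
    then have "x \<otimes> (\<one> \<oplus> w) \<in> I" using x Icarr[OF w(1)] by (simp add: I_r_closed)
    with w(2) show ?thesis by blast
  qed
  then obtain e where e: "\<And>x. x \<in> I \<Longrightarrow> e x \<in> I" "\<And>x. x \<in> I \<Longrightarrow> expo x = \<one> \<oplus> e x"
    by metis
  have "inj_on e I"
  proof (rule inj_onI)
    fix x y assume xy: "x \<in> I" "y \<in> I" "e x = e y"
    have c: "x \<in> carrier R" "y \<in> carrier R" using xy Icarr by auto
    \<comment> \<open>A trivial kernel suffices, since \<open>expo y\<close> lies in 1 + I and can
      be cancelled.\<close>
    define d where "d = x \<oplus> (\<ominus> y)"
    have d: "d \<in> I" using xy by (simp add: d_def)
    have "y \<oplus> d = x" using c by (simp add: d_def a_ac r_neg2 r_neg)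
    then have "expo y \<otimes> expo d = expo y \<otimes> \<one>"
      using expo_add[OF xy(2) d] e xy expo_closed by simp
    moreover have "expo y \<in> Units R" using e xy one_plus_unit by simp
    ultimately have "expo d = \<one>" using Units_l_cancel expo_closed[OF d] by blast
    then have "d = \<zero>" by (rule expo_eq_one[OF d])
    with \<open>y \<oplus> d = x\<close> c show "x = y" by simp
  qed
  moreover have "\<one> \<oplus> e (x \<oplus> y) = (\<one> \<oplus> e x) \<otimes> (\<one> \<oplus> e y)" if "x \<in> I" "y \<in> I" for x y
    using expo_add[OF that] e that by simp
  ultimately show ?thesis using e(1) by blast
qed

end

section \<open>Regular embeddings as nilpotent products\<close>

text \<open>A finite commutative radical ring without unit: \<otimes> is its addition, \<star> its
  multiplication, and the last axiom makes the circle operation invertible.\<close>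

locale radical_product = comm_group G for G (structure) +
  fixes star :: "'a \<Rightarrow> 'a \<Rightarrow> 'a" (infixl \<open>\<star>\<close> 75)
  assumes finite_carrier: "finite (carrier G)"
    and star_closed [simp, intro]: "\<lbrakk>x \<in> carrier G; y \<in> carrier G\<rbrakk> \<Longrightarrow> x \<star> y \<in> carrier G"
    and star_comm: "\<lbrakk>x \<in> carrier G; y \<in> carrier G\<rbrakk> \<Longrightarrow> x \<star> y = y \<star> x"
    and star_distrib: "\<lbrakk>x \<in> carrier G; y \<in> carrier G; z \<in> carrier G\<rbrakk>
      \<Longrightarrow> x \<star> (y \<otimes> z) = (x \<star> y) \<otimes> (x \<star> z)"
    and star_assoc: "\<lbrakk>x \<in> carrier G; y \<in> carrier G; z \<in> carrier G\<rbrakk>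
      \<Longrightarrow> (x \<star> y) \<star> z = x \<star> (y \<star> z)"
    and circle_inverse: "x \<in> carrier G \<Longrightarrow> \<exists>y\<in>carrier G. x \<otimes> y \<otimes> (x \<star> y) = \<one>"
begin

lemma star_distrib_left: "\<lbrakk>x \<in> carrier G; y \<in> carrier G; z \<in> carrier G\<rbrakk>
    \<Longrightarrow> (y \<otimes> z) \<star> x = (y \<star> x) \<otimes> (z \<star> x)"
  using star_distrib[of x y z] by (simp add: star_comm)

lemma star_pow:
  assumes "x \<in> carrier G" "y \<in> carrier G"
  shows "x \<star> (y [^] (k::int)) = (x \<star> y) [^] k" "(y [^] k) \<star> x = (y \<star> x) [^] k"
proof -
  have "(\<lambda>y. x \<star> y) \<in> hom G G"
    using assms by (intro homI) (auto simp: star_distrib)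
  then show 1: "x \<star> (y [^] k) = (x \<star> y) [^] k"
    using hom_int_pow[of "\<lambda>y. x \<star> y" G G y k] assms is_group by simp
  then show "(y [^] k) \<star> x = (y \<star> x) [^] k"
    using assms by (simp add: star_comm[of _ x])
qed

lemma star_one: "x \<in> carrier G \<Longrightarrow> x \<star> \<one> = \<one>" "x \<in> carrier G \<Longrightarrow> \<one> \<star> x = \<one>"
  using star_pow[of x \<one> 0] by simp_all

text \<open>The unitization of the ring with additive group G and product \<open>\<star>\<close>.\<close>
definition dorroh :: "(int \<times> 'a) ring" where
  "dorroh = \<lparr>carrier = UNIV \<times> carrier G,
    monoid.mult = (\<lambda>(a, x) (b, y). (a * b, x [^] b \<otimes> y [^] a \<otimes> (x \<star> y))),
    monoid.one = (1, \<one>), ring.zero = (0, \<one>), ring.add = (\<lambda>(a, x) (b, y). (a + b, x \<otimes> y))\<rparr>"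

lemma dorroh_simps [simp]:
  "(a, x) \<in> carrier dorroh \<longleftrightarrow> x \<in> carrier G"
  "(a, x) \<otimes>\<^bsub>dorroh\<^esub> (b, y) = (a * b, x [^] b \<otimes> y [^] a \<otimes> (x \<star> y))"
  "\<one>\<^bsub>dorroh\<^esub> = (1, \<one>)" "\<zero>\<^bsub>dorroh\<^esub> = (0, \<one>)"
  "(a, x) \<oplus>\<^bsub>dorroh\<^esub> (b, y) = (a + b, x \<otimes> y)"
  by (simp_all add: dorroh_def)

lemma cring_dorroh: "cring dorroh"
proof (rule cringI)
  show "abelian_group dorroh"
  proof (rule abelian_groupI)
    fix u assume "u \<in> carrier dorroh"
    then obtain a x where u: "u = (a, x)" "x \<in> carrier G" by (cases u) auto
    then have "(- a, inv x) \<in> carrier dorroh" "(- a, inv x) \<oplus>\<^bsub>dorroh\<^esub> u = \<zero>\<^bsub>dorroh\<^esub>"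
      by simp_all
    then show "\<exists>v\<in>carrier dorroh. v \<oplus>\<^bsub>dorroh\<^esub> u = \<zero>\<^bsub>dorroh\<^esub>" by blast
  qed (auto simp: m_ac)
  show "comm_monoid dorroh"
  proof (rule comm_monoidI)
    fix u v w assume "u \<in> carrier dorroh" "v \<in> carrier dorroh" "w \<in> carrier dorroh"
    then obtain a x b y c z where eq: "u = (a, x)" "v = (b, y)" "w = (c, z)"
      and [simp]: "x \<in> carrier G" "y \<in> carrier G" "z \<in> carrier G"
      by (cases u; cases v; cases w) auto
    have "(x [^] b \<otimes> y [^] a \<otimes> (x \<star> y)) [^] c \<otimes> z [^] (a * b)
          \<otimes> ((x [^] b \<otimes> y [^] a \<otimes> (x \<star> y)) \<star> z)
        = x [^] (b * c) \<otimes> (y [^] c \<otimes> z [^] b \<otimes> (y \<star> z)) [^] a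
          \<otimes> (x \<star> (y [^] c \<otimes> z [^] b \<otimes> (y \<star> z)))"
      by (simp add: int_pow_distrib int_pow_pow star_distrib star_distrib_left star_pow star_assoc
          m_ac mult.commute)
    then show "u \<otimes>\<^bsub>dorroh\<^esub> v \<otimes>\<^bsub>dorroh\<^esub> w = u \<otimes>\<^bsub>dorroh\<^esub> (v \<otimes>\<^bsub>dorroh\<^esub> w)"
      by (simp add: eq)
  qed (auto simp: m_ac star_comm star_one mult.commute)
  show "(u \<oplus>\<^bsub>dorroh\<^esub> v) \<otimes>\<^bsub>dorroh\<^esub> w = u \<otimes>\<^bsub>dorroh\<^esub> w \<oplus>\<^bsub>dorroh\<^esub> v \<otimes>\<^bsub>dorroh\<^esub> w"
    if "u \<in> carrier dorroh" "v \<in> carrier dorroh" "w \<in> carrier dorroh" for u v w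
    using that by (cases u; cases v; cases w)
      (simp add: int_pow_distrib int_pow_mult star_distrib_left m_ac distrib_right)
qed

theorem exists_circle_exponential:
  assumes small: "\<And>p. \<lbrakk>Factorial_Ring.prime p; p dvd order G\<rbrakk> \<Longrightarrow> multiplicity p (order G) < p"
  shows "\<exists>f. f \<in> carrier G \<rightarrow> carrier G \<and> inj_on f (carrier G) \<and>
    (\<forall>x\<in>carrier G. \<forall>y\<in>carrier G. f (x \<otimes> y) = f x \<otimes> f y \<otimes> (f x \<star> f y))"
proof -
  let ?I = "{0} \<times> carrier G"
  interpret D: cring dorroh by (rule cring_dorroh)
  have neg: "\<ominus>\<^bsub>dorroh\<^esub> (0, x) = (0, inv x)" if "x \<in> carrier G" for x
    by (rule D.minus_equality) (use that in auto)
  have "subgroup ?I (add_monoid dorroh)"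
    by (rule D.add.subgroupI) (auto simp: neg)
  then have "ideal ?I dorroh"
    by (intro idealI) (auto simp: D.ring_axioms star_one)
  moreover have "\<one>\<^bsub>dorroh\<^esub> \<oplus>\<^bsub>dorroh\<^esub> u \<in> Units dorroh" if "u \<in> ?I" for u
  proof -
    from that obtain x where x: "u = (0, x)" "x \<in> carrier G" by auto
    then obtain y where y: "y \<in> carrier G" "x \<otimes> y \<otimes> (x \<star> y) = \<one>"
      using circle_inverse by blast
    \<comment> \<open>The second coordinate of this product is the circle operation of x and y, so a
      circle inverse is a ring inverse.\<close>
    then have "(1, x) \<otimes>\<^bsub>dorroh\<^esub> (1, y) = \<one>\<^bsub>dorroh\<^esub>" using x by simp
    then have "(1, x) \<in> Units dorroh"
      using x y D.unit_factor[of "(1, x)" "(1, y)"] D.Units_one_closed by simp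
    with x show ?thesis by simp
  qed
  moreover have "card ?I = order G" by (simp add: order_def card_cartesian_product)
  ultimately interpret S: small_radical_ideal dorroh ?I
    using finite_carrier small D.cring_axioms
    by (intro small_radical_ideal.intro radical_ideal.intro small_radical_ideal_axioms.intro
        radical_ideal_axioms.intro) auto
  obtain e where e: "e \<in> ?I \<rightarrow> ?I" "inj_on e ?I"
    "\<And>u v. u \<in> ?I \<Longrightarrow> v \<in> ?I \<Longrightarrow> \<one>\<^bsub>dorroh\<^esub> \<oplus>\<^bsub>dorroh\<^esub> e (u \<oplus>\<^bsub>dorroh\<^esub> v)
      = (\<one>\<^bsub>dorroh\<^esub> \<oplus>\<^bsub>dorroh\<^esub> e u) \<otimes>\<^bsub>dorroh\<^esub> (\<one>\<^bsub>dorroh\<^esub> \<oplus>\<^bsub>dorroh\<^esub> e v)"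
    using S.truncated_exponential by blast
  define f where "f x = snd (e (0, x))" for x
  have ef: "e (0, x) = (0, f x)" "f x \<in> carrier G" if "x \<in> carrier G" for x
    using e(1) that by (auto simp: f_def Pi_iff mem_Times_iff prod_eq_iff)
  have "inj_on f (carrier G)"
  proof (rule inj_onI)
    fix x y assume xy: "x \<in> carrier G" "y \<in> carrier G" "f x = f y"
    then have "e (0, x) = e (0, y)" by (simp add: ef)
    with e(2) xy show "x = y" by (auto dest: inj_onD)
  qed
  moreover have "f (x \<otimes> y) = f x \<otimes> f y \<otimes> (f x \<star> f y)"
    if "x \<in> carrier G" "y \<in> carrier G" for x y
    using e(3)[of "(0, x)" "(0, y)"] that by (simp add: ef)
  ultimately show ?thesis using ef by blast
qed

end

section \<open>The radical ring attached to a regular embedding\<close>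

locale abelian_regular_embedding = G: comm_group G + \<Gamma>: comm_group \<Gamma>
  for G :: "('b, 'd) monoid_scheme" (structure) and \<Gamma> :: "('a, 'c) monoid_scheme" +
  fixes \<beta> :: "'a \<Rightarrow> 'b \<Rightarrow> 'b"
  assumes finite_carrier: "finite (carrier G)"
    and regular: "\<beta> \<in> regular_embeddings \<Gamma> G"
begin

text \<open>The inverse of the orbit map of \<one>, a bijection from \<Gamma> to G by
  regularity.\<close>

definition elt :: "'b \<Rightarrow> 'a" where
  "elt u = (THE \<gamma>. \<gamma> \<in> carrier \<Gamma> \<and> \<beta> \<gamma> \<one> = u)"

text \<open>The group law of \<Gamma> carried over to G along the orbit map.\<close>

definition circ :: "'b \<Rightarrow> 'b \<Rightarrow> 'b" where
  "circ u v = \<beta> (elt u) v"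

text \<open>In additive notation, (u circ v) - (u + v): the ring product recovered from its circle
  operation.\<close>

definition star :: "'b \<Rightarrow> 'b \<Rightarrow> 'b" (infixl \<open>\<star>\<close> 75) where
  "u \<star> v = circ u v \<otimes> inv (u \<otimes> v)"

lemma unique_translation:
  "\<lbrakk>u \<in> carrier G; v \<in> carrier G\<rbrakk> \<Longrightarrow> \<exists>!\<gamma>. \<gamma> \<in> carrier \<Gamma> \<and> \<beta> \<gamma> u = v"
  using regular unfolding regular_embeddings_def by blast

lemma beta_mult:
  "\<lbrakk>\<gamma> \<in> carrier \<Gamma>; \<delta> \<in> carrier \<Gamma>; u \<in> carrier G\<rbrakk> \<Longrightarrow> \<beta> (\<gamma> \<otimes>\<^bsub>\<Gamma>\<^esub> \<delta>) u = \<beta> \<gamma> (\<beta> \<delta> u)"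
  using regular by (simp add: regular_embeddings_def compose_def)

lemma elt:
  assumes "u \<in> carrier G"
  shows elt_closed: "elt u \<in> carrier \<Gamma>" and beta_elt: "\<beta> (elt u) \<one> = u"
  using theI'[OF unique_translation[OF G.one_closed assms]] by (simp_all add: elt_def)

lemma elt_eqI: "\<lbrakk>\<gamma> \<in> carrier \<Gamma>; u \<in> carrier G; \<beta> \<gamma> \<one> = u\<rbrakk> \<Longrightarrow> elt u = \<gamma>"
  using unique_translation[OF G.one_closed, of u] elt[of u] by blast

lemma circ_affine:
  assumes "u \<in> carrier G"
  shows "\<exists>\<alpha>\<in>hom G G. \<forall>v\<in>carrier G. circ u v = \<alpha> v \<otimes> u"
proof -
  have "\<beta> (elt u) \<in> Hol G"
    using regular elt_closed[OF assms] by (auto simp: regular_embeddings_def)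
  then obtain h \<alpha> where h: "h \<in> carrier G" and \<alpha>: "\<alpha> \<in> iso G G"
    and eq: "\<beta> (elt u) = compose (carrier G) (rho_perm G h) \<alpha>"
    by (auto simp: Hol_def Aut_def)
  have hom: "\<alpha> \<in> hom G G" using \<alpha> by (simp add: iso_def)
  have *: "\<beta> (elt u) v = \<alpha> v \<otimes> inv h" if "v \<in> carrier G" for v
    using that hom_in_carrier[OF hom that] by (simp add: eq compose_def rho_perm_def)
  have "\<alpha> \<one> = \<one>" using hom_one[OF hom] G.is_group by simp
  \<comment> \<open>Evaluation at \<one>, which \<alpha> fixes, identifies the translation
    part.\<close>
  then have "inv h = u" using *[of \<one>] beta_elt[OF assms] h by simp
  then show ?thesis using * hom by (auto simp: circ_def)
qed

lemma circ_closed [simp]: "\<lbrakk>u \<in> carrier G; v \<in> carrier G\<rbrakk> \<Longrightarrow> circ u v \<in> carrier G"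
  using circ_affine[of u] by (auto dest: hom_in_carrier)

lemma elt_circ:
  assumes "u \<in> carrier G" "v \<in> carrier G"
  shows "elt (circ u v) = elt u \<otimes>\<^bsub>\<Gamma>\<^esub> elt v"
  using assms by (intro elt_eqI) (simp_all add: elt_closed beta_mult beta_elt, simp add: circ_def)

lemma circ_comm: "\<lbrakk>u \<in> carrier G; v \<in> carrier G\<rbrakk> \<Longrightarrow> circ u v = circ v u"
  by (metis \<Gamma>.m_comm beta_elt circ_closed elt_circ elt_closed)

lemma circ_assoc:
  assumes "u \<in> carrier G" "v \<in> carrier G" "w \<in> carrier G"
  shows "circ (circ u v) w = circ u (circ v w)"
  using assms elt_circ[of u v] by (simp add: circ_def[of "circ u v"] beta_mult elt_closed flip: circ_def)

text \<open>If \<gamma> moves u to \<one>, the inverse is \<open>\<beta> \<gamma> \<one>\<close>: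
  commutativity of \<Gamma> lets \<open>elt u\<close> act after \<gamma> instead of before
  it.\<close>

lemma circ_inverse: "u \<in> carrier G \<Longrightarrow> \<exists>v\<in>carrier G. circ u v = \<one>"
proof -
  assume u: "u \<in> carrier G"
  obtain \<gamma> where \<gamma>: "\<gamma> \<in> carrier \<Gamma>" "\<beta> \<gamma> u = \<one>"
    using unique_translation[OF u G.one_closed] by blast
  have "\<beta> (\<gamma> \<otimes>\<^bsub>\<Gamma>\<^esub> elt u) \<one> = \<one>"
    using \<gamma> u by (simp add: beta_mult elt_closed beta_elt)
  moreover have "\<beta> \<gamma> \<one> \<in> carrier G"
  proof -
    have "\<beta> \<gamma> \<in> Hol G" using regular \<gamma> by (auto simp: regular_embeddings_def)
    then obtain h \<alpha> where "h \<in> carrier G" "\<alpha> \<in> hom G G"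
      "\<beta> \<gamma> = compose (carrier G) (rho_perm G h) \<alpha>"
      by (auto simp: Hol_def Aut_def iso_def)
    then show ?thesis by (auto simp: compose_def rho_perm_def dest: hom_in_carrier)
  qed
  ultimately show ?thesis
    using \<gamma> u by (metis \<Gamma>.m_comm beta_elt beta_mult circ_def elt_closed G.one_closed)
qed

lemma star_closed [simp]: "\<lbrakk>u \<in> carrier G; v \<in> carrier G\<rbrakk> \<Longrightarrow> u \<star> v \<in> carrier G"
  by (simp add: star_def)

lemma circ_eq:
  assumes [simp]: "u \<in> carrier G" "v \<in> carrier G"
  shows "circ u v = u \<otimes> v \<otimes> (u \<star> v)"
proof -
  have "u \<otimes> v \<otimes> (u \<star> v) = circ u v \<otimes> ((u \<otimes> v) \<otimes> inv (u \<otimes> v))"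
    unfolding star_def by (simp only: G.m_lcomm G.m_closed G.inv_closed circ_closed assms)
  also have "\<dots> = circ u v" by (simp only: G.r_inv G.r_one G.m_closed circ_closed assms)
  finally show ?thesis by simp
qed

lemma star_comm: "\<lbrakk>u \<in> carrier G; v \<in> carrier G\<rbrakk> \<Longrightarrow> u \<star> v = v \<star> u"
  by (simp add: star_def circ_comm G.m_comm)

text \<open>Membership in the holomorph gives u \<star> x = \<alpha>(x) - x additively, a difference
  of two endomorphisms of an abelian group.\<close>

lemma star_distrib:
  assumes [simp]: "u \<in> carrier G" "v \<in> carrier G" "w \<in> carrier G"
  shows "u \<star> (v \<otimes> w) = (u \<star> v) \<otimes> (u \<star> w)"
proof -
  obtain \<alpha> where \<alpha>: "\<alpha> \<in> hom G G" "\<And>v. v \<in> carrier G \<Longrightarrow> circ u v = \<alpha> v \<otimes> u"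
    using circ_affine[of u] by auto
  have [simp]: "\<alpha> x \<in> carrier G" if "x \<in> carrier G" for x
    by (rule hom_in_carrier[OF \<alpha>(1) that])
  have "u \<star> x = \<alpha> x \<otimes> inv x" if "x \<in> carrier G" for x
  proof -
    have "u \<star> x = \<alpha> x \<otimes> (u \<otimes> (inv u \<otimes> inv x))"
      unfolding star_def using that by (simp add: \<alpha>(2) G.inv_mult G.m_assoc)
    also have "u \<otimes> (inv u \<otimes> inv x) = inv x"
      using that by (simp flip: G.m_assoc)
    finally show ?thesis .
  qed
  then show ?thesis by (simp add: hom_mult[OF \<alpha>(1)] G.inv_mult G.m_ac)
qed

text \<open>Both bracketings of \<open>circ\<close> expand to the same \<open>?c\<close>, made of
  the three elements and their pairwise products, times a triple product. Associativity of
  \<open>circ\<close> and cancellation equate the triple products.\<close>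

lemma star_assoc:
  assumes [simp]: "u \<in> carrier G" "v \<in> carrier G" "w \<in> carrier G"
  shows "(u \<star> v) \<star> w = u \<star> (v \<star> w)"
proof -
  have dl: "(x \<otimes> y) \<star> z = (x \<star> z) \<otimes> (y \<star> z)"
    if "x \<in> carrier G" "y \<in> carrier G" "z \<in> carrier G" for x y z
    using that star_distrib[of z x y] by (simp add: star_comm)
  let ?c = "u \<otimes> v \<otimes> w \<otimes> (u \<star> v) \<otimes> (u \<star> w) \<otimes> (v \<star> w)"
  have "circ (circ u v) w = ?c \<otimes> ((u \<star> v) \<star> w)"
    by (simp add: circ_eq dl G.m_ac)
  moreover have "circ u (circ v w) = ?c \<otimes> (u \<star> (v \<star> w))"
    by (simp add: circ_eq star_distrib G.m_ac)
  ultimately have "?c \<otimes> ((u \<star> v) \<star> w) = ?c \<otimes> (u \<star> (v \<star> w))"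
    using circ_assoc[of u v w] by simp
  then show ?thesis by (simp del: G.m_assoc)
qed

lemma radical_product_star: "radical_product G star"
  using finite_carrier circ_inverse
  by unfold_locales (auto simp: star_distrib star_assoc circ_eq intro: star_comm)

theorem type_isomorphic:
  assumes small: "\<And>p. \<lbrakk>Factorial_Ring.prime p; p dvd order G\<rbrakk> \<Longrightarrow> multiplicity p (order G) < p"
    and order: "order G = order \<Gamma>"
  shows "G \<cong> \<Gamma>"
proof -
  obtain f where f: "f \<in> carrier G \<rightarrow> carrier G" "inj_on f (carrier G)"
    "\<And>x y. \<lbrakk>x \<in> carrier G; y \<in> carrier G\<rbrakk> \<Longrightarrow> f (x \<otimes> y) = f x \<otimes> f y \<otimes> (f x \<star> f y)"
    using radical_product.exists_circle_exponential[OF radical_product_star small] by blast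
  have fc: "f x \<in> carrier G" if "x \<in> carrier G" for x
    using f(1) that by blast
  \<comment> \<open>\<open>elt\<close> is an isomorphism from the circle group to \<Gamma>, so it is
    composed with the exponential f.\<close>
  define h where "h x = elt (f x)" for x
  have "h (x \<otimes> y) = h x \<otimes>\<^bsub>\<Gamma>\<^esub> h y" if "x \<in> carrier G" "y \<in> carrier G" for x y
    using that fc by (simp add: h_def f(3) elt_circ flip: circ_eq)
  then have hom: "h \<in> hom G \<Gamma>"
    using fc by (intro homI) (auto simp: h_def elt_closed)
  have inj: "inj_on h (carrier G)"
  proof (rule inj_onI)
    fix x y assume xy: "x \<in> carrier G" "y \<in> carrier G" "h x = h y"
    then have "f x = f y"
      using beta_elt[OF fc[OF xy(1)]] beta_elt[OF fc[OF xy(2)]] by (metis h_def)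
    then show "x = y" using f(2) xy by (simp add: inj_on_eq_iff)
  qed
  have "order \<Gamma> > 0"
    using finite_carrier G.order_gt_0_iff_finite order by simp
  then have "finite (carrier \<Gamma>)" by (simp add: \<Gamma>.order_gt_0_iff_finite)
  moreover have "h ` carrier G \<subseteq> carrier \<Gamma>" using hom by (auto simp: hom_def)
  ultimately have "h ` carrier G = carrier \<Gamma>"
    using order card_image[OF inj] by (simp add: card_subset_eq order_def)
  then show ?thesis
    using hom inj by (intro is_isoI) (simp add: iso_def bij_betw_def)
qed

end

theorem theorem3:
  fixes \<Gamma> :: "('a, 'c) monoid_scheme" and G :: "('b, 'd) monoid_scheme"
  assumes "comm_group \<Gamma>" and "finite (carrier \<Gamma>)"
    and "\<forall>p::nat. Factorial_Ring.prime p \<and> p dvd order \<Gamma> \<longrightarrow>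
           multiplicity p (order \<Gamma>) < p - 1 \<or> (p \<le> 3 \<and> multiplicity p (order \<Gamma>) < p)"
    and "comm_group G" and "order G = order \<Gamma>"
    and "e_HGS \<Gamma> G \<noteq> 0"
  shows "G \<cong> \<Gamma>"
proof -
  \<comment> \<open>A nonzero number of conjugacy classes provides at least one regular
    embedding.\<close>
  have "regular_embeddings \<Gamma> G \<noteq> {}"
    using assms(6) by (auto simp: e_HGS_def quotient_def)
  then obtain \<beta> where \<beta>: "\<beta> \<in> regular_embeddings \<Gamma> G" by blast
  have "order \<Gamma> > 0"
    using assms(1,2) by (simp add: monoid.order_gt_0_iff_finite comm_group.axioms(2) group.is_monoid)
  then have "finite (carrier G)"
    using assms(5) by (metis order_def card_gt_0_iff)
  with \<beta> assms(1,4) have "abelian_regular_embedding G \<Gamma> \<beta>"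
    by (intro abelian_regular_embedding.intro abelian_regular_embedding_axioms.intro)
  \<comment> \<open>Both alternatives of the hypothesis yield v < p.\<close>
  moreover have "multiplicity p (order G) < p"
    if "Factorial_Ring.prime p" "p dvd order G" for p :: nat
    using assms(3)[rule_format, of p] that assms(5) by auto
  ultimately show ?thesis
    using abelian_regular_embedding.type_isomorphic assms(5) by blast
qed

end
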